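(* Let $\mathcal{H}=\mathrm{L}(l,h,w,y)$ be a tight minimum distance diagram of area $N$, where $N\neq3t^2$ for every integer $t$. Then, for an integer $m\ge1$, the extension $m\mathcal{H}=\mathrm{L}(ml,mh,mw,my)$ is tight if and only if \[1\leq m\leq\left\lfloor\frac{1}{\lceil\sqrt{3N}\rceil-\sqrt{3N}}\right\rfloor.\]
   Context: For integers $0\le w<l$, $0\le y<h$, the L-shape $\mathrm{L}(l,h,w,y)=\{(i,j)\in\mathbb{Z}^2:0\le i<l,0\le j<h\}\setminus\{(i,j):l-w\le i<l,h-y\le j<h\}$ has area $lh-wy$ and diameter $l+h-\min\{w,y\}-2$. A minimum distance diagram is such an L-shape that is the image of a minimum distance diagram map $\psi:\mathrm{G}\to\mathbb{N}^2$ of a $2$--Cayley digraph $\mathrm{Cay}(\mathrm{G},\{a,b\})$ ($\mathrm{G}$ finite Abelian generated by nonzero $a,b$; $\psi(\eta)=(i,j)$ with $ia+jb=\eta$, $i+j$ minimal, image closed under coordinatewise smaller vectors in $\mathbb{N}^2$). With $\mathrm{lb}(N)=\lceil\sqrt{3N}\rceil-2$, an L-shape of area $N$ is tight if its diameter equals $\mathrm{lb}(N)$. *)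

theory Defs
  imports Complex_Main "HOL-Algebra.Generated_Groups"
begin

text \<open>All coordinates and parameters of an L-shape are nonnegative, so it is a subset of
  \<open>nat \<times> nat\<close>. The truncated subtractions are exact under the side conditions
  \<open>w < l\<close> and \<open>y < h\<close>.\<close>

definition L_shape :: "nat \<Rightarrow> nat \<Rightarrow> nat \<Rightarrow> nat \<Rightarrow> (nat \<times> nat) set" where
  "L_shape l h w y =
     {(i, j). i < l \<and> j < h} - {(i, j). l - w \<le> i \<and> i < l \<and> h - y \<le> j \<and> j < h}"

definition area :: "(nat \<times> nat) set \<Rightarrow> nat" where
  "area H = card H"

text \<open>In a minimum distance diagram, \<open>i + j\<close> is the distance from the identity to the vertex
  placed at \<open>(i, j)\<close>.\<close>

definition diameter :: "(nat \<times> nat) set \<Rightarrow> nat" where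
  "diameter H = Max ((\<lambda>(i, j). i + j) ` H)"

definition lb :: "nat \<Rightarrow> int" where
  "lb N = \<lceil>sqrt (3 * real N)\<rceil> - 2"

definition tight :: "(nat \<times> nat) set \<Rightarrow> bool" where
  "tight H \<longleftrightarrow> int (diameter H) = lb (area H)"

text \<open>The group is written multiplicatively: \<open>i a + j b\<close> is
  \<open>a [^] i \<otimes> b [^] j\<close>, and nonzero means different from \<open>\<one>\<close>. A digraph
  \<open>Cay(G, {a, b})\<close> is represented by the data \<open>(G, a, b)\<close> that determine it.\<close>

locale two_cayley_digraph = comm_group G for G (structure) +
  fixes a b
  assumes finite_carrier: "finite (carrier G)"
    and a_closed: "a \<in> carrier G" and b_closed: "b \<in> carrier G"
    and a_nonzero: "a \<noteq> \<one>" and b_nonzero: "b \<noteq> \<one>"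
    and generated: "generate G {a, b} = carrier G"
begin

definition mdd_map :: "('a \<Rightarrow> nat \<times> nat) \<Rightarrow> bool" where
  "mdd_map \<psi> \<longleftrightarrow>
     (\<forall>\<eta>\<in>carrier G. case \<psi> \<eta> of (i, j) \<Rightarrow>
        a [^] i \<otimes> b [^] j = \<eta> \<and>
        (\<forall>i' j' :: nat. a [^] i' \<otimes> b [^] j' = \<eta> \<longrightarrow> i + j \<le> i' + j')) \<and>
     (\<forall>(i, j)\<in>\<psi> ` carrier G. \<forall>i' j'. i' \<le> i \<and> j' \<le> j \<longrightarrow> (i', j') \<in> \<psi> ` carrier G)"

definition minimum_distance_diagram :: "nat \<Rightarrow> nat \<Rightarrow> nat \<Rightarrow> nat \<Rightarrow> bool" where
  "minimum_distance_diagram l h w y \<longleftrightarrow>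
     w < l \<and> y < h \<and> (\<exists>\<psi>. mdd_map \<psi> \<and> \<psi> ` carrier G = L_shape l h w y)"

end

lemma area_L_shape:
  assumes "w < l" "y < h"
  shows "area (L_shape l h w y) = l * h - w * y"
proof -
  have eq: "L_shape l h w y = {..<l} \<times> {..<h} - {l-w..<l} \<times> {h-y..<h}"
    unfolding L_shape_def by auto
  have "{l-w..<l} \<times> {h-y..<h} \<subseteq> {..<l} \<times> {..<h}" by auto
  then have "card (L_shape l h w y) = l * h - (l - (l-w)) * (h - (h-y))"
    unfolding eq by (subst card_Diff_subset) (auto simp: card_cartesian_product)
  then show ?thesis using assms unfolding area_def by simp
qed

lemma diameter_L_shape:
  assumes "w < l" "y < h"
  shows "diameter (L_shape l h w y) = l + h - min w y - 2"
  unfolding diameter_def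
proof (rule Max_eqI)
  have "L_shape l h w y \<subseteq> {..<l} \<times> {..<h}" unfolding L_shape_def by auto
  then show "finite ((\<lambda>(i, j). i + j) ` L_shape l h w y)"
    by (meson finite_SigmaI finite_imageI finite_lessThan finite_subset)
next
  fix d assume "d \<in> (\<lambda>(i, j). i + j) ` L_shape l h w y"
  then obtain i j where "d = i + j" "i < l" "j < h" "i < l - w \<or> j < h - y"
    unfolding L_shape_def by (fastforce simp: not_le)
  then show "d \<le> l + h - min w y - 2" by linarith
next
  show "l + h - min w y - 2 \<in> (\<lambda>(i, j). i + j) ` L_shape l h w y"
  proof (cases "w \<le> y")
    case True
    then show ?thesis using assms unfolding L_shape_def
      by (intro image_eqI[where x = "(l - w - 1, h - 1)"]) auto
  next
    case False
    then show ?thesis using assms unfolding L_shape_def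
      by (intro image_eqI[where x = "(l - 1, h - y - 1)"]) auto
  qed
qed

end

theory Submission
  imports Defs "HOL-Computational_Algebra.Primes"
begin

text \<open>Put \<open>s = sqrt (3 N)\<close> and \<open>c = \<lceil>s\<rceil>\<close>. Scaling by \<open>m\<close> multiplies the area by \<open>m\<^sup>2\<close> and
  the diameter plus \<open>2\<close> by \<open>m\<close>, so \<open>m\<H>\<close> is tight iff \<open>\<lceil>m s\<rceil> = m c\<close>, that is, iff
  \<open>m (c - s) < 1\<close>. The hypothesis on \<open>N\<close> excludes \<open>c = s\<close>, and then \<open>m (c - s) = 1\<close> is impossible
  because \<open>s\<close> would be rational, hence an integer; so the strict inequality may be replaced by
  \<open>m \<le> 1 / (c - s)\<close>.\<close>

text \<open>As 3 is prime, it divides \<open>c\<close> itself. This turns an integral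
  \<open>sqrt (3 * N)\<close> into the excluded form of \<open>N\<close>.\<close>

lemma three_mult_eq_squareE:
  fixes n c :: int
  assumes "3 * n = c\<^sup>2"
  obtains t where "n = 3 * t\<^sup>2"
proof -
  have "3 dvd c\<^sup>2" using assms by (metis dvd_triv_left)
  then have "3 dvd c" using prime_dvd_power[of 3 c 2] by simp
  then obtain t where "c = 3 * t" ..
  then have "n = 3 * t\<^sup>2" using assms by (simp add: power_mult_distrib)
  then show thesis by (rule that)
qed

lemma tight_L_shape_iff:
  assumes "w < l" "y < h"
  shows "tight (L_shape l h w y) \<longleftrightarrow>
    int (l + h - min w y) = \<lceil>sqrt (3 * real (area (L_shape l h w y)))\<rceil>"
proof -
  \<comment> \<open>Makes the truncated \<open>- 2\<close> of the diameter exact, so that it cancels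
    the \<open>- 2\<close> of \<open>lb\<close>.\<close>
  have "2 \<le> l + h - min w y" using assms by linarith
  then show ?thesis
    unfolding tight_def lb_def diameter_L_shape[OF assms] by (simp add: of_nat_diff algebra_simps)
qed

lemma area_L_shape_mult:
  assumes "w < l" "y < h" "0 < m"
  shows "area (L_shape (m * l) (m * h) (m * w) (m * y)) = m\<^sup>2 * area (L_shape l h w y)"
  using assms by (simp add: area_L_shape power2_eq_square diff_mult_distrib2 algebra_simps)

text \<open>The upper bound of the ceiling condition is automatic from s \<le>
  \<open>\<lceil>s\<rceil>\<close>; only the strict lower bound remains.\<close>

lemma ceiling_mult_nat_eq_iff:
  fixes s :: real
  shows "\<lceil>real m * s\<rceil> = int m * \<lceil>s\<rceil> \<longleftrightarrow> real m * (of_int \<lceil>s\<rceil> - s) < 1"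
proof -
  have "real m * s \<le> real m * of_int \<lceil>s\<rceil>"
    by (intro mult_left_mono le_of_int_ceiling) simp
  then show ?thesis by (simp add: ceiling_eq_iff algebra_simps)
qed

lemma mult_ceiling_gap_sqrt_neq_1:
  "real m * (of_int \<lceil>sqrt (real k)\<rceil> - sqrt (real k)) \<noteq> 1"
proof
  let ?s = "sqrt (real k)" and ?c = "\<lceil>sqrt (real k)\<rceil>"
  assume eq: "real m * (of_int ?c - ?s) = 1"
  then have "real m * ?s = of_int (int m * ?c - 1)" by (simp add: algebra_simps)
  then have "(real m * ?s)\<^sup>2 = (of_int (int m * ?c - 1))\<^sup>2" by simp
  then have "of_int ((int m)\<^sup>2 * int k) = (of_int ((int m * ?c - 1)\<^sup>2) :: real)"
    by (simp add: power_mult_distrib)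
  then have "(int m)\<^sup>2 * int k = (int m * ?c - 1)\<^sup>2" unfolding of_int_eq_iff .
  then have "(int m)\<^sup>2 dvd (int m * ?c - 1)\<^sup>2" by (metis dvd_triv_left)
  \<comment> \<open>Divisibility of squares passes to their roots; this forces \<open>m = 1\<close>,
    hence a gap of exactly 1, whereas a ceiling gap is always below 1.\<close>
  then have "int m dvd int m * ?c - 1" by simp
  then have "int m dvd 1" by (metis dvd_diff_right_iff dvd_triv_left)
  then have "of_int ?c - ?s = 1" using eq by simp
  then show False by linarith
qed

theorem theorem5:
  fixes G (structure) and a b and l h w y N m :: nat
  assumes "two_cayley_digraph G a b"
    and "two_cayley_digraph.minimum_distance_diagram G a b l h w y"
    and "area (L_shape l h w y) = N"
    and "tight (L_shape l h w y)"
    and "\<forall>t :: int. int N \<noteq> 3 * t ^ 2"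
    and "m \<ge> 1"
  shows "tight (L_shape (m * l) (m * h) (m * w) (m * y)) \<longleftrightarrow>
    1 \<le> m \<and> int m \<le> \<lfloor>1 / (of_int \<lceil>sqrt (3 * real N)\<rceil> - sqrt (3 * real N))\<rfloor>"
proof -
  interpret two_cayley_digraph G a b by (rule assms(1))
  let ?s = "sqrt (3 * real N)"
  let ?c = "\<lceil>?s\<rceil>"
  have m: "0 < m" using assms(6) by simp
  have wl: "w < l" and yh: "y < h"
    using assms(2) unfolding minimum_distance_diagram_def by auto
  have mwl: "m * w < m * l" and myh: "m * y < m * h" using wl yh m by auto
  have c: "int (l + h - min w y) = ?c"
    using assms(4) unfolding tight_L_shape_iff[OF wl yh] assms(3) .
  have "m * l + m * h - min (m * w) (m * y) = m * (l + h - min w y)"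
    by (simp add: nat_mult_min_right diff_mult_distrib2 distrib_left)
  moreover have "sqrt (3 * real (m\<^sup>2 * N)) = real m * ?s"
    by (simp add: real_sqrt_mult)
  ultimately have "tight (L_shape (m * l) (m * h) (m * w) (m * y)) \<longleftrightarrow>
      \<lceil>real m * ?s\<rceil> = int m * ?c"
    unfolding tight_L_shape_iff[OF mwl myh] area_L_shape_mult[OF wl yh m] assms(3)
    using c by (metis of_nat_mult)
  also have "\<dots> \<longleftrightarrow> real m * (of_int ?c - ?s) < 1"
    by (rule ceiling_mult_nat_eq_iff)
  also have "\<dots> \<longleftrightarrow> real m * (of_int ?c - ?s) \<le> 1"
    using mult_ceiling_gap_sqrt_neq_1[of m "3 * N"] by auto
  also have "\<dots> \<longleftrightarrow> real m \<le> 1 / (of_int ?c - ?s)"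
  proof -
    \<comment> \<open>The gap must be positive before dividing by it; here N \<noteq> 3 t^2
      enters.\<close>
    have "?s \<noteq> of_int ?c"
    proof
      assume "?s = of_int ?c"
      then have "?s\<^sup>2 = (of_int ?c)\<^sup>2" by simp
      then have "of_int (3 * int N) = (of_int (?c\<^sup>2) :: real)" by simp
      then have "3 * int N = ?c\<^sup>2" unfolding of_int_eq_iff .
      then show False using assms(5) by (metis three_mult_eq_squareE)
    qed
    then have "0 < of_int ?c - ?s" using le_of_int_ceiling[of ?s] by linarith
    then show ?thesis by (simp add: pos_le_divide_eq)
  qed
  also have "\<dots> \<longleftrightarrow> 1 \<le> m \<and> int m \<le> \<lfloor>1 / (of_int ?c - ?s)\<rfloor>"
    using assms(6) by (simp add: le_floor_iff)
  finally show ?thesis .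
qed

end
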